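(* Let $\alpha_0>0$ be irrational, and let $\Delta$ and $\theta$ be as in the context. (a) If $\theta(\alpha_0)<\Delta(\alpha_0)$, then $\Delta$ is differentiable at $\alpha_0$ and $\Delta'(\alpha_0)=0$. (b) If $\theta(\alpha_0)>\Delta(\alpha_0)$, then $\Delta$ is not differentiable at $\alpha_0$.
   Context: For real $\beta>1$ let $T_\beta(x)=\beta x\bmod 1$ on $[0,1]$, and let $d_\beta(1)=(x_i)_{i\ge1}$, $x_i=\lfloor\beta T_\beta^{i-1}(1)\rfloor$, be the $\beta$-expansion of $1$ (finite if it ends in zeros, trailing zeros omitted). For coprime $0<p<q$ the word $t'_{p,q}=a'_0\cdots a'_{q-1}$, $a'_i=\lceil (i+1)p/q\rceil-\lceil ip/q\rceil$, factors as $1z_{p,q}0$ (central word $z_{p,q}$). For irrational $\gamma\in(0,1)$, the word $(\lceil\gamma(n+1)\rceil-\lceil\gamma n\rceil)_{n\ge0}$ has the form $1c_\gamma$ (characteristic word $c_\gamma$). Over alphabet $\{a,b\}$ means $0\mapsto a$, $1\mapsto b$. $\Delta:[0,\infty)\to\mathbb R$: $\Delta(0)=1$; $\Delta(b)=b+1$ for integers $b\ge1$; for $\alpha\in(b-1,b)$ ($b\ge1$ integer), $\Delta(\alpha)$ is the unique $\beta>1$ with $d_\beta(1)=b\,c_{\alpha-b+1}$ over $\{b-1,b\}$ if $\alpha$ is irrational, resp. $d_\beta(1)=b\,z_{p,q}\,b$ over $\{b-1,b\}$ if $\alpha-b+1=p/q$ in lowest terms. For real $t$, $\|t\|=\min_{n\in\mathbb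 Z}|t-n|$. The irrationality base of an irrational $\alpha$ is $\theta(\alpha)=\sup\{\lambda:\liminf_{q\to\infty}\frac{\lambda^q}{q}\|q\alpha\|=0\}\in[1,\infty]$. *)

theory Defs
  imports Complex_Main "HOL-Library.Extended_Real"
begin

definition beta_map :: "real \<Rightarrow> real \<Rightarrow> real" where
  "beta_map \<beta> x = frac (\<beta> * x)"

text \<open>Digits are indexed from 0: \<^term>\<open>beta_digit \<beta> i\<close> is the digit \<open>x\<close> with index \<open>i + 1\<close> of the
  \<open>\<beta>\<close>-expansion of 1. Finite words are lists, infinite words are functions on \<^typ>\<open>nat\<close>; the
  letters 0 and 1, and later \<open>b - 1\<close> and \<open>b\<close>, are integers.\<close>

definition beta_digit :: "real \<Rightarrow> nat \<Rightarrow> int" where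
  "beta_digit \<beta> i = \<lfloor>\<beta> * (beta_map \<beta> ^^ i) 1\<rfloor>"

text \<open>An expansion that ends in zeros is identified with the finite word left after deleting the
  trailing zeros; any other expansion is an infinite word.\<close>

definition has_finite_expansion :: "real \<Rightarrow> int list \<Rightarrow> bool" where
  "has_finite_expansion \<beta> w \<longleftrightarrow>
     w \<noteq> [] \<and> last w \<noteq> 0 \<and>
     (\<forall>i. beta_digit \<beta> i = (if i < length w then w ! i else 0))"

definition has_infinite_expansion :: "real \<Rightarrow> (nat \<Rightarrow> int) \<Rightarrow> bool" where
  "has_infinite_expansion \<beta> w \<longleftrightarrow>
     (\<forall>N. \<exists>i\<ge>N. beta_digit \<beta> i \<noteq> 0) \<and> (\<forall>i. beta_digit \<beta> i = w i)"

definition christoffel_word :: "nat \<Rightarrow> nat \<Rightarrow> int list" where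
  "christoffel_word p q =
     map (\<lambda>i. \<lceil>real (i + 1) * real p / real q\<rceil> - \<lceil>real i * real p / real q\<rceil>) [0..<q]"

text \<open>For coprime \<open>0 < p < q\<close> the word above is \<open>1 z 0\<close>; deleting its first and last letter
  gives \<open>z\<close>.\<close>

definition central_word :: "nat \<Rightarrow> nat \<Rightarrow> int list" where
  "central_word p q = butlast (tl (christoffel_word p q))"

definition upper_mechanical_word :: "real \<Rightarrow> nat \<Rightarrow> int" where
  "upper_mechanical_word \<gamma> n = \<lceil>\<gamma> * real (n + 1)\<rceil> - \<lceil>\<gamma> * real n\<rceil>"

definition characteristic_word :: "real \<Rightarrow> nat \<Rightarrow> int" where
  "characteristic_word \<gamma> n = upper_mechanical_word \<gamma> (Suc n)"

text \<open>Replaces the letters 0 and 1 by \<open>b - 1\<close> and \<open>b\<close>.\<close>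

definition recode :: "int \<Rightarrow> int \<Rightarrow> int" where
  "recode b x = (if x = 0 then b - 1 else b)"

text \<open>For noninteger \<open>\<alpha> > 0\<close>, the integer \<open>b \<ge> 1\<close> with \<open>b - 1 < \<alpha> < b\<close> is \<open>\<lceil>\<alpha>\<rceil>\<close>. The domain of
  \<open>\<Delta>\<close> is \<open>[0, \<infinity>)\<close>; values at negative arguments are unspecified.\<close>

definition Delta :: "real \<Rightarrow> real" where
  "Delta \<alpha> =
     (if \<alpha> < 0 then undefined
      else if \<alpha> = 0 then 1
      else if \<alpha> \<in> \<int> then \<alpha> + 1
      else let b = \<lceil>\<alpha>\<rceil> in
        if \<alpha> \<in> \<rat> then
          (THE \<beta>. \<beta> > 1 \<and>
             (\<exists>p q. 0 < p \<and> p < q \<and> coprime p q \<and> \<alpha> - of_int b + 1 = real p / real q \<and>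
                has_finite_expansion \<beta> (b # map (recode b) (central_word p q) @ [b])))
        else
          (THE \<beta>. \<beta> > 1 \<and>
             has_infinite_expansion \<beta>
               (case_nat b (\<lambda>n. recode b (characteristic_word (\<alpha> - of_int b + 1) n)))))"

definition nearest_int_dist :: "real \<Rightarrow> real" where
  "nearest_int_dist t = (INF n::int. \<bar>t - of_int n\<bar>)"

definition irrationality_base :: "real \<Rightarrow> ereal" where
  "irrationality_base \<alpha> =
     Sup {ereal r | r.
       liminf (\<lambda>q::nat. ereal (r ^ q / real q * nearest_int_dist (real q * \<alpha>))) = 0}"

end

theory Submission
  imports Defs
begin

text \<open>
  Put \<open>x = 1 / \<beta>\<close>. The digits prescribed for \<open>\<Delta>(\<alpha>)\<close> are \<open>\<lceil>\<alpha>(n+1)\<rceil> - \<lceil>\<alpha>n\<rceil>\<close> (for rational \<open>\<alpha>\<close>, up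
  to passing from the finite greedy expansion to the periodic quasi-greedy one), so Abel summation
  turns the expansion of 1 into the equation \<open>K(\<alpha>, x) = \<Sum>n. (\<lceil>\<alpha>n\<rceil> - 1) x\<^sup>n = 0\<close>; conversely,
  subadditivity of the ceiling makes the solution of this equation have the prescribed greedy
  digits. Near its root, \<open>K(\<alpha>\<^sub>0, \<cdot>)\<close> is bi-Lipschitz, so \<open>\<Delta>(\<alpha>) - \<Delta>(\<alpha>\<^sub>0)\<close> is comparable to
  \<open>K(\<alpha>, x) - K(\<alpha>\<^sub>0, x)\<close> at \<open>x = 1 / \<Delta>(\<alpha>)\<close>. The \<open>n\<close>-th term of that difference vanishes unless
  \<open>\<parallel>n\<alpha>\<^sub>0\<parallel> \<le> n\<bar>\<alpha> - \<alpha>\<^sub>0\<bar>\<close>. If \<open>\<parallel>n\<alpha>\<^sub>0\<parallel> \<ge> c n \<lambda>\<^sup>-\<^sup>n\<close> with \<open>\<lambda> < \<Delta>(\<alpha>\<^sub>0)\<close>, only terms with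
  \<open>\<lambda>\<^sup>-\<^sup>n \<le> \<bar>\<alpha> - \<alpha>\<^sub>0\<bar> / c\<close> survive and the difference is \<open>o(\<alpha> - \<alpha>\<^sub>0)\<close>. If instead
  \<open>\<lambda>\<^sup>q \<parallel>q\<alpha>\<^sub>0\<parallel> / q\<close> gets arbitrarily small for some \<open>\<lambda> > \<Delta>(\<alpha>\<^sub>0)\<close>, then near \<open>\<alpha>\<^sub>0\<close> the single term
  \<open>n = q\<close>, of size \<open>x\<^sup>q\<close>, makes the difference quotients unbounded.
\<close>

section \<open>The series attached to a slope\<close>

text \<open>This is K of the overview. The term \<open>n = 0\<close> contributes -1 and, for
  \<alpha> > 0, all later coefficients are nonnegative, so the function increases on [0, 1) from the
  value -1.\<close>

definition ceil_series :: "real \<Rightarrow> real \<Rightarrow> real" where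
  "ceil_series \<alpha> x = (\<Sum>n. (of_int \<lceil>\<alpha> * real n\<rceil> - 1) * x ^ n)"

lemma summable_linear_growth:
  fixes a :: "nat \<Rightarrow> real"
  assumes "\<And>n. \<bar>a n\<bar> \<le> C * real (Suc n)" and "\<bar>x\<bar> < 1"
  shows "summable (\<lambda>n. a n * x ^ n)"
proof (rule summable_comparison_test')
  have "summable (\<lambda>n. real (Suc n) * \<bar>x\<bar> ^ n)"
    using geometric_deriv_sums[of "\<bar>x\<bar>"] assms(2) sums_summable by auto
  then show "summable (\<lambda>n. C * (real (Suc n) * \<bar>x\<bar> ^ n))"
    by (rule summable_mult)
  show "norm (a n * x ^ n) \<le> C * (real (Suc n) * \<bar>x\<bar> ^ n)" for n
    using mult_right_mono[OF assms(1), of "\<bar>x\<bar> ^ n" n]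
    by (simp add: abs_mult power_abs mult.assoc)
qed

lemma abs_ceiling_le: "\<bar>of_int \<lceil>t\<rceil>\<bar> \<le> \<bar>t\<bar> + (1::real)"
  by linarith

lemma summable_ceiling:
  fixes x :: real
  assumes "\<bar>x\<bar> < 1"
  shows "summable (\<lambda>n. of_int \<lceil>\<alpha> * real (n + i)\<rceil> * x ^ n)"
proof (rule summable_linear_growth[OF _ assms])
  fix n
  have "\<bar>\<alpha> * real (n + i)\<bar> = \<bar>\<alpha>\<bar> * real n + \<bar>\<alpha>\<bar> * real i"
    by (simp only: abs_mult abs_of_nat) (simp add: algebra_simps)
  then have "\<bar>of_int \<lceil>\<alpha> * real (n + i)\<rceil>\<bar> \<le> \<bar>\<alpha>\<bar> * real n + \<bar>\<alpha>\<bar> * real i + 1"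
    using abs_ceiling_le[of "\<alpha> * real (n + i)"] by simp
  also have "\<dots> \<le> (\<bar>\<alpha>\<bar> + \<bar>\<alpha>\<bar> * real i + 1) * real (Suc n)"
    by (simp add: algebra_simps)
  finally show "\<bar>of_int \<lceil>\<alpha> * real (n + i)\<rceil>\<bar> \<le> (\<bar>\<alpha>\<bar> + \<bar>\<alpha>\<bar> * real i + 1) * real (Suc n)" .
qed

lemma summable_ceil_series:
  fixes x :: real
  assumes "\<bar>x\<bar> < 1"
  shows "summable (\<lambda>n. (of_int \<lceil>\<alpha> * real n\<rceil> - 1) * x ^ n)"
  using summable_diff[OF summable_ceiling[OF assms, of \<alpha> 0] summable_geometric[of x]] assms
  by (simp add: left_diff_distrib)

lemma ceil_series_eq:
  fixes x :: real
  assumes "\<bar>x\<bar> < 1"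
  shows "ceil_series \<alpha> x = (\<Sum>n. of_int \<lceil>\<alpha> * real n\<rceil> * x ^ n) - 1 / (1 - x)"
  using suminf_diff[OF summable_ceiling[OF assms, of \<alpha> 0] summable_geometric[of x]] assms
  by (simp add: ceil_series_def left_diff_distrib suminf_geometric)

lemma ceil_series_differentiable:
  assumes "\<bar>x\<bar> < 1"
  obtains D where "(ceil_series \<alpha> has_real_derivative D) (at x)"
proof -
  obtain y where y: "\<bar>x\<bar> < y" "y < 1"
    using assms dense by blast
  then have "summable (\<lambda>n. (of_int \<lceil>\<alpha> * real n\<rceil> - 1) * y ^ n)"
    by (intro summable_ceil_series) auto
  from termdiffs_strong[OF this, of x] y that show ?thesis
    unfolding ceil_series_def[abs_def] by auto
qed

section \<open>Monotonicity in x and the root in (0, 1)\<close>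

lemma ceiling_mult_ge_1: "\<alpha> > 0 \<Longrightarrow> n > 0 \<Longrightarrow> of_int \<lceil>\<alpha> * real n\<rceil> \<ge> (1::real)"
  by (metis mult_pos_pos of_int_1_le_iff of_nat_0_less_iff zero_less_ceiling
      zless_imp_add1_zle add_0)

text \<open>The constant terms cancel and every other term of the difference is nonnegative, so the
  k-th one alone, with coefficient at least 1, bounds it from below.\<close>

lemma ceil_series_growth:
  assumes "\<alpha> > 0" "k > 0" "\<lceil>\<alpha> * real k\<rceil> \<ge> 2" "0 \<le> x" "x \<le> y" "y < 1"
  shows "y ^ k - x ^ k \<le> ceil_series \<alpha> y - ceil_series \<alpha> x"
proof -
  let ?a = "\<lambda>n. of_int \<lceil>\<alpha> * real n\<rceil> - 1 :: real"
  let ?f = "\<lambda>n. ?a n * (y ^ n - x ^ n)"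
  have sx: "summable (\<lambda>n. ?a n * x ^ n)" and sy: "summable (\<lambda>n. ?a n * y ^ n)"
    using assms by (auto intro!: summable_ceil_series)
  have nonneg: "?f n \<ge> 0" for n
    using ceiling_mult_ge_1[OF assms(1), of n] assms
    by (cases "n = 0") (auto intro!: mult_nonneg_nonneg power_mono)
  have "y ^ k - x ^ k \<le> ?f k"
    using mult_right_mono[of 1 "?a k" "y ^ k - x ^ k"] assms by (auto intro: power_mono)
  also have "\<dots> = sum ?f {k}"
    by simp
  also have "\<dots> \<le> suminf ?f"
    using summable_diff[OF sy sx] nonneg
    by (intro sum_le_suminf) (auto simp: right_diff_distrib)
  also have "\<dots> = ceil_series \<alpha> y - ceil_series \<alpha> x"
    using suminf_diff[OF sy sx] by (simp add: ceil_series_def right_diff_distrib)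
  finally show ?thesis .
qed

lemma ex_ceiling_ge:
  assumes "\<alpha> > 0" "m > 0"
  obtains k :: nat where "k > 0" "\<lceil>\<alpha> * real k\<rceil> \<ge> m"
proof -
  obtain k :: nat where k: "of_int m < real k * \<alpha>"
    using assms reals_Archimedean3 by blast
  then have "k > 0"
    using assms by (cases k) auto
  moreover have "\<lceil>\<alpha> * real k\<rceil> \<ge> m"
    using k by (simp add: le_ceiling_iff mult.commute)
  ultimately show ?thesis
    by (rule that)
qed

lemma power_diff_ge:
  fixes x y :: real
  assumes "0 \<le> x" "x \<le> y" "k > 0"
  shows "y ^ (k - 1) * (y - x) \<le> y ^ k - x ^ k"
proof -
  obtain j where k: "k = Suc j"
    using assms by (cases k) auto
  have "x * x ^ j \<le> x * y ^ j"
    using assms by (intro mult_left_mono power_mono) auto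
  then show ?thesis
    by (simp add: k algebra_simps)
qed

text \<open>The constant \<open>x ^ (k - 1)\<close> depends on x but not on y, so with x a fixed
  root the bound serves every y on either side; it turns an estimate of the series into one of the
  distance to the root.\<close>

lemma ceil_series_expanding:
  assumes "\<alpha> > 0" "k > 0" "\<lceil>\<alpha> * real k\<rceil> \<ge> 2" "0 \<le> x" "x < 1" "0 \<le> y" "y < 1"
  shows "x ^ (k - 1) * \<bar>y - x\<bar> \<le> \<bar>ceil_series \<alpha> y - ceil_series \<alpha> x\<bar>"
proof (cases "x \<le> y")
  case True
  have "x ^ (k - 1) * (y - x) \<le> y ^ (k - 1) * (y - x)"
    using True assms by (intro mult_right_mono power_mono) auto
  then show ?thesis
    using power_diff_ge[of x y k] ceil_series_growth[of \<alpha> k x y] assms True by simp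
next
  case False
  then show ?thesis
    using power_diff_ge[of y x k] ceil_series_growth[of \<alpha> k y x] assms
    by (simp add: abs_if not_le)
qed

lemma ceil_series_strict_mono:
  assumes "\<alpha> > 0" "0 \<le> x" "x < y" "y < 1"
  shows "ceil_series \<alpha> x < ceil_series \<alpha> y"
proof -
  obtain k where k: "k > 0" "\<lceil>\<alpha> * real k\<rceil> \<ge> 2"
    using ex_ceiling_ge[OF assms(1), of 2] by auto
  have "x ^ k < y ^ k"
    using assms k by (intro power_strict_mono) auto
  then show ?thesis
    using ceil_series_growth[OF assms(1) k, of x y] assms by linarith
qed

text \<open>The value at 0 is -1, so by continuity it suffices to find a point where the series is
  nonnegative.\<close>

lemma ceil_series_root_exists:
  assumes "\<alpha> > 0"
  obtains x where "0 < x" "x < 1" "ceil_series \<alpha> x = 0"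
proof -
  obtain k where k: "k > 0" "\<lceil>\<alpha> * real k\<rceil> \<ge> 3"
    using ex_ceiling_ge[OF assms, of 3] by auto
  \<comment> \<open>At this y the coefficient at index k, at least 2, contributes at least 1, which
    compensates the term -1 at index 0.\<close>
  define y where "y = root k (1 / 2)"
  have y: "0 < y" "y < 1" "y ^ k = 1 / 2"
    using k unfolding y_def by (auto simp: real_root_lt_1_iff)
  have at0: "ceil_series \<alpha> 0 = -1"
    by (simp add: ceil_series_def powser_zero)
  let ?f = "\<lambda>n. (of_int \<lceil>\<alpha> * real n\<rceil> - 1) * y ^ n"
  have "?f 0 + ?f k = sum ?f {0, k}"
    using k by simp
  also have "\<dots> \<le> suminf ?f"
  proof (rule sum_le_suminf)
    show "0 \<le> ?f n" if "n \<in> - {0, k}" for n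
      using that ceiling_mult_ge_1[OF assms, of n] y by simp
  qed (use y in \<open>auto intro!: summable_ceil_series\<close>)
  finally have "?f 0 + ?f k \<le> suminf ?f" .
  moreover have "real_of_int \<lceil>\<alpha> * real k\<rceil> \<ge> 3"
    using k by linarith
  then have "?f k \<ge> 1"
    unfolding y(3) by (simp add: field_simps)
  moreover have "?f 0 = -1"
    by simp
  ultimately have "0 \<le> ceil_series \<alpha> y"
    unfolding ceil_series_def by linarith
  moreover have "isCont (ceil_series \<alpha>) z" if "0 \<le> z \<and> z \<le> y" for z
    using ceil_series_differentiable[of z \<alpha>] that y by (metis DERIV_isCont abs_of_nonneg le_less_trans)
  ultimately obtain x where x: "0 \<le> x" "x \<le> y" "ceil_series \<alpha> x = 0"
    using IVT[of "ceil_series \<alpha>" 0 0 y] at0 y by auto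
  then show ?thesis
    using that[of x] at0 y by (cases "x = 0") auto
qed

section \<open>The beta-expansion with Sturmian digits\<close>

definition slope_digit :: "real \<Rightarrow> nat \<Rightarrow> int" where
  "slope_digit \<alpha> n = \<lceil>\<alpha> * real (Suc n)\<rceil> - \<lceil>\<alpha> * real n\<rceil>"

text \<open>For \<open>x = 1 / \<beta>\<close> this is the value of the digit word from position i
  on, the remainder that has to equal the i-th iterate of 1 under \<open>beta_map \<beta>\<close> if
  these are the greedy digits.\<close>

definition digit_tail :: "real \<Rightarrow> real \<Rightarrow> nat \<Rightarrow> real" where
  "digit_tail \<alpha> x i = (\<Sum>n. of_int (slope_digit \<alpha> (n + i)) * x ^ Suc n)"

lemma slope_digit_nonneg: "\<alpha> > 0 \<Longrightarrow> slope_digit \<alpha> n \<ge> 0"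
  unfolding slope_digit_def by (simp add: ceiling_mono)

lemma summable_slope_digit:
  fixes x :: real
  assumes "\<bar>x\<bar> < 1"
  shows "summable (\<lambda>n. of_int (slope_digit \<alpha> (n + i)) * x ^ Suc n)"
proof -
  have "summable (\<lambda>n. x * (of_int \<lceil>\<alpha> * real (n + Suc i)\<rceil> * x ^ n - of_int \<lceil>\<alpha> * real (n + i)\<rceil> * x ^ n))"
    by (intro summable_mult summable_diff summable_ceiling assms)
  then show ?thesis
    by (simp add: slope_digit_def algebra_simps)
qed

lemma digit_tail_rec:
  assumes "\<bar>x\<bar> < 1"
  shows "digit_tail \<alpha> x i = x * (of_int (slope_digit \<alpha> i) + digit_tail \<alpha> x (Suc i))"
proof -
  have "(\<Sum>n. of_int (slope_digit \<alpha> (Suc n + i)) * x ^ Suc (Suc n)) =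
      x * digit_tail \<alpha> x (Suc i)"
    unfolding digit_tail_def
    by (subst suminf_mult[OF summable_slope_digit[OF assms], symmetric]) (simp add: algebra_simps)
  then show ?thesis
    using suminf_split_head[OF summable_slope_digit[OF assms, of \<alpha> i]]
    by (simp add: digit_tail_def algebra_simps)
qed

lemma digit_tail_nonneg: "\<alpha> > 0 \<Longrightarrow> 0 \<le> x \<Longrightarrow> x < 1 \<Longrightarrow> digit_tail \<alpha> x i \<ge> 0"
  unfolding digit_tail_def
  by (intro suminf_nonneg summable_slope_digit) (auto simp: slope_digit_nonneg)

lemma summable_ceiling_diff:
  fixes x :: real
  assumes "\<bar>x\<bar> < 1"
  shows "summable (\<lambda>n. of_int (\<lceil>\<alpha> * real (n + i)\<rceil> - \<lceil>\<alpha> * real i\<rceil>) * x ^ n)"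
  using summable_diff[OF summable_ceiling[OF assms, of \<alpha> i]
      summable_mult[OF summable_geometric[of x], of "of_int \<lceil>\<alpha> * real i\<rceil>"]] assms
  by (simp add: left_diff_distrib)

text \<open>Abel summation: the digits are the increments of the bracketed ceiling difference, which
  is 0 at n = 0, so the index shift loses no term.\<close>

lemma digit_tail_eq:
  assumes "\<bar>x\<bar> < 1"
  shows "digit_tail \<alpha> x i =
    (1 - x) * (\<Sum>n. of_int (\<lceil>\<alpha> * real (n + i)\<rceil> - \<lceil>\<alpha> * real i\<rceil>) * x ^ n)"
proof -
  let ?A = "\<lambda>n. of_int (\<lceil>\<alpha> * real (n + i)\<rceil> - \<lceil>\<alpha> * real i\<rceil>) * x ^ n"
  have sA: "summable ?A"
    by (rule summable_ceiling_diff[OF assms])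
  then have sA': "summable (\<lambda>n. ?A (Suc n))"
    by (rule iffD2[OF summable_Suc_iff[of ?A]])
  have "digit_tail \<alpha> x i = (\<Sum>n. ?A (Suc n) - x * ?A n)"
    by (simp add: digit_tail_def slope_digit_def algebra_simps)
  also have "\<dots> = (\<Sum>n. ?A (Suc n)) - x * suminf ?A"
    using suminf_diff[OF sA' summable_mult[OF sA, of x]] suminf_mult[OF sA, of x] by simp
  also have "\<dots> = (1 - x) * suminf ?A"
    using suminf_split_head[OF sA] by (simp add: algebra_simps)
  finally show ?thesis .
qed

text \<open>The case i = 0 of \<open>digit_tail_eq\<close>, with 1 written as 1 - x times the
  geometric series.\<close>

lemma digit_tail_0_eq_1_iff:
  assumes "\<bar>x\<bar> < 1"
  shows "digit_tail \<alpha> x 0 = 1 \<longleftrightarrow> ceil_series \<alpha> x = 0"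
proof -
  have "digit_tail \<alpha> x 0 - 1 = (1 - x) * ceil_series \<alpha> x"
    using digit_tail_eq[OF assms, of \<alpha> 0] ceil_series_eq[OF assms, of \<alpha>] assms
    by (simp add: right_diff_distrib)
  then show ?thesis
    using assms by auto
qed

text \<open>Subadditivity of the ceiling bounds each coefficient in \<open>digit_tail_eq\<close> by
  the one for i = 0, where the value is exactly 1. Strictness needs one index at which subadditivity
  is strict.\<close>

lemma digit_tail_less_1:
  assumes "0 < x" "x < 1" "ceil_series \<alpha> x = 0" "\<alpha> * real i \<notin> \<int>"
  shows "digit_tail \<alpha> x i < 1"
proof -
  let ?A = "\<lambda>n. \<lceil>\<alpha> * real (n + i)\<rceil> - \<lceil>\<alpha> * real i\<rceil>"
  have le: "?A n \<le> \<lceil>\<alpha> * real n\<rceil>" for n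
    using ceiling_add_le[of "\<alpha> * real n" "\<alpha> * real i"] by (simp add: algebra_simps)
  have "\<exists>n. ?A n \<noteq> \<lceil>\<alpha> * real n\<rceil>"
  proof (rule ccontr)
    assume "\<not> ?thesis"
    then have add: "\<lceil>\<alpha> * real (n + i)\<rceil> = \<lceil>\<alpha> * real n\<rceil> + \<lceil>\<alpha> * real i\<rceil>" for n
      by (metis diff_eq_eq)
    have mult: "\<lceil>\<alpha> * real (k * i)\<rceil> = int k * \<lceil>\<alpha> * real i\<rceil>" for k
    proof (induction k)
      case (Suc k)
      then show ?case
        using add[of "k * i"] by (simp add: algebra_simps)
    qed simp
    \<comment> \<open>The rounding gap at i is positive. Additivity along the multiples of i would
      make the gap at \<open>k * i\<close> equal to \<open>k * t\<close>, but a gap is always less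
      than 1.\<close>
    define t where "t = of_int \<lceil>\<alpha> * real i\<rceil> - \<alpha> * real i"
    have "t \<ge> 0"
      unfolding t_def by linarith
    moreover have "t \<noteq> 0"
      using assms(4) unfolding t_def by (metis Ints_of_int eq_iff_diff_eq_0)
    ultimately obtain k where k: "1 < real k * t"
      using reals_Archimedean3[of t] by auto
    have "real_of_int \<lceil>\<alpha> * real (k * i)\<rceil> < \<alpha> * real (k * i) + 1"
      by linarith
    then show False
      using k mult[of k] by (simp add: t_def algebra_simps)
  qed
  then obtain m where m: "?A m < \<lceil>\<alpha> * real m\<rceil>"
    using le by (metis order_le_less)
  have x: "\<bar>x\<bar> < 1"
    using assms by simp
  have sA: "summable (\<lambda>n. of_int (?A n) * x ^ n)"
    by (rule summable_ceiling_diff[OF x])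
  have sB: "summable (\<lambda>n. of_int \<lceil>\<alpha> * real n\<rceil> * x ^ n)"
    using summable_ceiling[OF x, of \<alpha> 0] by simp
  have "0 < (\<Sum>n. of_int \<lceil>\<alpha> * real n\<rceil> * x ^ n - of_int (?A n) * x ^ n)"
  proof (rule suminf_pos2[OF summable_diff[OF sB sA], of m])
    have "real_of_int (?A n) \<le> of_int \<lceil>\<alpha> * real n\<rceil>" for n
      using le of_int_le_iff by blast
    then show "0 \<le> of_int \<lceil>\<alpha> * real n\<rceil> * x ^ n - of_int (?A n) * x ^ n" for n
      using assms(1) by (simp add: mult_right_mono del: of_int_diff)
    have "real_of_int (?A m) < of_int \<lceil>\<alpha> * real m\<rceil>"
      using m of_int_less_iff by blast
    then show "0 < of_int \<lceil>\<alpha> * real m\<rceil> * x ^ m - of_int (?A m) * x ^ m"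
      using assms(1) by (simp del: of_int_diff)
  qed
  then have "(\<Sum>n. of_int (?A n) * x ^ n) < (\<Sum>n. of_int \<lceil>\<alpha> * real n\<rceil> * x ^ n)"
    using suminf_diff[OF sB sA] by linarith
  also have "\<dots> = 1 / (1 - x)"
    using ceil_series_eq[OF x] assms(3) by simp
  finally show ?thesis
    using digit_tail_eq[OF x, of \<alpha> i] assms by (simp add: field_simps)
qed

section \<open>Greedy expansions and the digits of a slope\<close>

text \<open>Remainders in [0, 1) let the floor recover each digit, so r is the orbit of 1. The start
  \<open>r 0 = 1\<close> is exempt from the strict bound.\<close>

lemma beta_expansion_greedy:
  assumes "r 0 = 1" "\<And>i. \<beta> * r i = of_int (d i) + r (Suc i)"
    and "\<And>i. 0 \<le> r (Suc i)" "\<And>i. r (Suc i) < 1"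
  shows "beta_digit \<beta> i = d i"
proof -
  have floor: "\<lfloor>\<beta> * r i\<rfloor> = d i" for i
    using assms(2-4)[of i] by (simp add: floor_eq_iff)
  have "(beta_map \<beta> ^^ i) 1 = r i" for i
    by (induction i) (simp_all add: assms(1,2) beta_map_def frac_def floor[unfolded assms(2)])
  then show ?thesis
    by (simp add: beta_digit_def floor)
qed

text \<open>Along the orbit t of 1 the partial sums telescope to
  \<open>1 - (1 / \<beta>) ^ n * t n\<close>, and t stays in [0, 1].\<close>

lemma beta_digit_sums:
  assumes "\<beta> > 1"
  shows "(\<lambda>i. of_int (beta_digit \<beta> i) * (1 / \<beta>) ^ Suc i) sums 1"
proof -
  define t where "t i = (beta_map \<beta> ^^ i) 1" for i
  have t: "0 \<le> t i" "t i \<le> 1" for i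
    by (cases i; simp add: t_def beta_map_def frac_lt_1 less_imp_le)+
  have step: "\<beta> * t i = of_int (beta_digit \<beta> i) + t (Suc i)" for i
    by (simp add: t_def beta_digit_def beta_map_def frac_def)
  have part: "(\<Sum>i<n. of_int (beta_digit \<beta> i) * (1 / \<beta>) ^ Suc i) = 1 - (1 / \<beta>) ^ n * t n" for n
  proof (induction n)
    case (Suc n)
    have "of_int (beta_digit \<beta> n) * (1 / \<beta>) ^ Suc n =
        (1 / \<beta>) ^ n * t n - (1 / \<beta>) ^ Suc n * t (Suc n)"
      using step[of n] assms by (simp add: field_simps)
    then show ?case
      using Suc by simp
  qed (simp add: t_def)
  have "(\<lambda>n. (1 / \<beta>) ^ n * t n) \<longlonglongrightarrow> 0"
  proof (rule tendsto_sandwich[of "\<lambda>_. 0" _ _ "\<lambda>n. (1 / \<beta>) ^ n"])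
    show "(\<lambda>n. (1 / \<beta>) ^ n) \<longlonglongrightarrow> 0"
      using assms by (intro LIMSEQ_power_zero) auto
    show "\<forall>\<^sub>F n in sequentially. (1 / \<beta>) ^ n * t n \<le> (1 / \<beta>) ^ n"
      using t assms by (intro always_eventually allI mult_right_le_one_le) auto
  qed (use t assms in auto)
  from tendsto_diff[OF tendsto_const[of 1] this] show ?thesis
    unfolding sums_def part by simp
qed

lemma slope_digit_bounds: "slope_digit \<alpha> n \<in> {\<lceil>\<alpha>\<rceil> - 1, \<lceil>\<alpha>\<rceil>}"
proof -
  have "\<alpha> * real (Suc n) = \<alpha> * real n + \<alpha>"
    by (simp add: algebra_simps)
  then show ?thesis
    unfolding slope_digit_def by simp linarith
qed

text \<open>Lowering the slope by the integer \<open>\<lceil>\<alpha>\<rceil> - 1\<close> lowers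
  every digit by it; since only two digits occur, \<open>recode\<close> undoes the shift.\<close>

lemma recode_upper_mechanical_word:
  "recode \<lceil>\<alpha>\<rceil> (upper_mechanical_word (\<alpha> - of_int \<lceil>\<alpha>\<rceil> + 1) n) = slope_digit \<alpha> n"
proof -
  have shift: "\<lceil>(\<alpha> - of_int \<lceil>\<alpha>\<rceil> + 1) * real m\<rceil> = \<lceil>\<alpha> * real m\<rceil> - (\<lceil>\<alpha>\<rceil> - 1) * int m" for m
  proof -
    have "(\<alpha> - of_int \<lceil>\<alpha>\<rceil> + 1) * real m = \<alpha> * real m - of_int ((\<lceil>\<alpha>\<rceil> - 1) * int m)"
      by (simp add: algebra_simps)
    then show ?thesis
      by (simp only: ceiling_diff_of_int)
  qed
  have "upper_mechanical_word (\<alpha> - of_int \<lceil>\<alpha>\<rceil> + 1) n = slope_digit \<alpha> n - (\<lceil>\<alpha>\<rceil> - 1)"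
    unfolding upper_mechanical_word_def slope_digit_def Suc_eq_plus1[symmetric] shift
    by (simp add: algebra_simps)
  then show ?thesis
    using slope_digit_bounds[of \<alpha> n] by (auto simp: recode_def)
qed

lemma slope_digit_0: "slope_digit \<alpha> 0 = \<lceil>\<alpha>\<rceil>"
  by (simp add: slope_digit_def)

text \<open>Otherwise the ceilings would be eventually constant. This matters when
  \<open>\<lceil>\<alpha>\<rceil> = 1\<close>: the smaller letter is then 0, and an infinite
  expansion must not end in zeros.\<close>

lemma slope_digit_nonzero_infinitely_often:
  assumes "\<alpha> > 0"
  shows "\<exists>i\<ge>N. slope_digit \<alpha> i \<noteq> 0"
proof (rule ccontr)
  assume "\<not> ?thesis"
  then have zero: "slope_digit \<alpha> i = 0" if "i \<ge> N" for i
    using that by blast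
  have const: "\<lceil>\<alpha> * real (N + k)\<rceil> = \<lceil>\<alpha> * real N\<rceil>" for k
  proof (induction k)
    case (Suc k)
    then show ?case
      using zero[of "N + k"] by (simp add: slope_digit_def)
  qed simp
  obtain k :: nat where k: "of_int \<lceil>\<alpha> * real N\<rceil> < real k * \<alpha>"
    using assms reals_Archimedean3 by blast
  have "real k * \<alpha> \<le> \<alpha> * real (N + k)"
    using assms by (simp add: algebra_simps)
  then show False
    using const[of k] k by linarith
qed

lemma beta_times_digit_tail:
  assumes "\<beta> > 1"
  shows "\<beta> * digit_tail \<alpha> (1 / \<beta>) i = of_int (slope_digit \<alpha> i) + digit_tail \<alpha> (1 / \<beta>) (Suc i)"
  using digit_tail_rec[of "1 / \<beta>" \<alpha> i] assms by simp

lemma irrational_mult_nat: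
  assumes "\<alpha> \<notin> \<rat>" "n > 0"
  shows "\<alpha> * real n \<notin> \<int>"
proof
  assume "\<alpha> * real n \<in> \<int>"
  then have "\<alpha> * real n / real n \<in> \<rat>"
    by (intro Rats_divide) (auto simp: Ints_subset_Rats[THEN subsetD])
  then show False
    using assms by simp
qed

text \<open>Given the digits, summing the expansion yields tail value 1 at position 0. Given the
  root, the tails form the orbit of 1, irrationality keeping every later tail below 1.\<close>

lemma has_infinite_expansion_iff:
  assumes "\<alpha> > 0" "\<alpha> \<notin> \<rat>" "\<beta> > 1"
  shows "has_infinite_expansion \<beta> (case_nat \<lceil>\<alpha>\<rceil>
           (\<lambda>n. recode \<lceil>\<alpha>\<rceil> (characteristic_word (\<alpha> - of_int \<lceil>\<alpha>\<rceil> + 1) n))) \<longleftrightarrow>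
         ceil_series \<alpha> (1 / \<beta>) = 0" (is "has_infinite_expansion \<beta> ?w \<longleftrightarrow> _")
proof -
  have w: "?w i = slope_digit \<alpha> i" for i
    by (cases i) (simp_all add: slope_digit_0 characteristic_word_def recode_upper_mechanical_word)
  have x: "\<bar>1 / \<beta>\<bar> < 1"
    using assms by simp
  show ?thesis
  proof
    assume "has_infinite_expansion \<beta> ?w"
    then have "beta_digit \<beta> = slope_digit \<alpha>"
      by (auto simp: has_infinite_expansion_def w)
    then have "digit_tail \<alpha> (1 / \<beta>) 0 = 1"
      using beta_digit_sums[OF assms(3)] by (simp add: digit_tail_def sums_iff)
    then show "ceil_series \<alpha> (1 / \<beta>) = 0"
      using digit_tail_0_eq_1_iff[OF x] by blast
  next
    assume root: "ceil_series \<alpha> (1 / \<beta>) = 0"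
    have "beta_digit \<beta> i = slope_digit \<alpha> i" for i
    proof (rule beta_expansion_greedy)
      show "digit_tail \<alpha> (1 / \<beta>) 0 = 1"
        using digit_tail_0_eq_1_iff[OF x] root by blast
      show "digit_tail \<alpha> (1 / \<beta>) (Suc i) < 1" for i
      proof (rule digit_tail_less_1[OF _ _ root])
        show "\<alpha> * real (Suc i) \<notin> \<int>"
          by (rule irrational_mult_nat[OF assms(2)]) simp
      qed (use assms in auto)
    qed (use assms in \<open>auto simp: beta_times_digit_tail digit_tail_nonneg\<close>)
    then show "has_infinite_expansion \<beta> ?w"
      using slope_digit_nonzero_infinitely_often[OF assms(1)]
      by (simp add: has_infinite_expansion_def w)
  qed
qed

section \<open>Rational slopes and finite expansions\<close>

lemma central_word_nth:
  assumes "i < q - 2"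
  shows "central_word p q ! i = upper_mechanical_word (real p / real q) (Suc i)"
proof -
  have "[0..<q] ! Suc i = Suc i"
    using assms by (subst nth_upt) auto
  then show ?thesis
    using assms
    by (simp add: central_word_def nth_butlast nth_tl christoffel_word_def
        upper_mechanical_word_def mult.commute)
qed

lemma length_central_word: "length (central_word p q) = q - 2"
  by (simp add: central_word_def christoffel_word_def)

text \<open>The digits of slope \<alpha> have period q, and the finite word is one period with its
  last letter raised by 1: the passage from the quasi-greedy to the greedy expansion of 1.\<close>

lemma has_finite_expansion_iff:
  assumes "\<alpha> > 0" "0 < p" "p < q" "coprime p q" "\<alpha> - of_int \<lceil>\<alpha>\<rceil> + 1 = real p / real q" "\<beta> > 1"
  shows "has_finite_expansion \<beta> (\<lceil>\<alpha>\<rceil> # map (recode \<lceil>\<alpha>\<rceil>) (central_word p q) @ [\<lceil>\<alpha>\<rceil>]) \<longleftrightarrow>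
         ceil_series \<alpha> (1 / \<beta>) = 0" (is "has_finite_expansion \<beta> ?w \<longleftrightarrow> _")
proof -
  have q: "q \<ge> 2"
    using assms by linarith
  have \<alpha>: "\<alpha> = of_int (\<lceil>\<alpha>\<rceil> - 1) + real p / real q"
    using assms(5) by simp
  have shift: "\<alpha> * real m = of_int ((\<lceil>\<alpha>\<rceil> - 1) * int m) + real (p * m) / real q" for m
    by (subst \<alpha>) (simp add: algebra_simps)
  have period: "slope_digit \<alpha> (i + q) = slope_digit \<alpha> i" for i
  proof -
    have "\<lceil>\<alpha> * real (m + q)\<rceil> = \<lceil>\<alpha> * real m\<rceil> + ((\<lceil>\<alpha>\<rceil> - 1) * int q + int p)" for m
    proof -
      have "\<alpha> * real (m + q) = \<alpha> * real m + of_int ((\<lceil>\<alpha>\<rceil> - 1) * int q + int p)"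
        using shift[of q] q by (simp add: algebra_simps)
      then show ?thesis
        by (simp only: ceiling_add_of_int)
    qed
    from this[of i] this[of "Suc i"] show ?thesis
      by (simp add: slope_digit_def)
  qed
  have last: "slope_digit \<alpha> (q - 1) = \<lceil>\<alpha>\<rceil> - 1"
  proof -
    let ?m = "(\<lceil>\<alpha>\<rceil> - 1) * int q + int p"
    have m: "\<alpha> * real q = of_int ?m"
      using shift[of q] q by simp
    have "\<alpha> * real (q - 1) = of_int ?m - \<alpha>"
      using m q by (simp add: of_nat_diff algebra_simps)
    moreover have "\<lceil>of_int ?m - \<alpha>\<rceil> = ?m - (\<lceil>\<alpha>\<rceil> - 1)"
    proof -
      have "0 < real p / real q" "real p / real q < 1"
        using assms(2,3) by auto
      then show ?thesis
        using assms(5) by (intro ceiling_unique) auto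
    qed
    moreover have "\<lceil>\<alpha> * real q\<rceil> = ?m"
      unfolding m by (rule ceiling_of_int)
    moreover have "Suc (q - 1) = q"
      using q by simp
    ultimately show ?thesis
      by (simp only: slope_digit_def)
  qed
  have len: "length ?w = q"
    using q by (simp add: length_central_word)
  \<comment> \<open>The extra 1 in the last digit stands for the whole periodic continuation, whose
    value as a remainder is 1.\<close>
  define e where "e i = (if i < q then slope_digit \<alpha> i + (if i = q - 1 then 1 else 0) else 0)" for i
  have w: "(if i < length ?w then ?w ! i else 0) = e i" for i
  proof (cases i)
    case 0
    then show ?thesis
      using q by (simp add: e_def slope_digit_0)
  next
    case (Suc j)
    consider "j < q - 2" | "j = q - 2" | "j > q - 2"
      by linarith
    then show ?thesis
    proof cases
      case 1
      then have "?w ! i = recode \<lceil>\<alpha>\<rceil> (upper_mechanical_word (\<alpha> - of_int \<lceil>\<alpha>\<rceil> + 1) i)"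
        using Suc assms(5) by (simp add: nth_append length_central_word central_word_nth)
      then show ?thesis
        using 1 Suc unfolding len e_def recode_upper_mechanical_word by auto
    next
      case 2
      then have "i = q - 1"
        using Suc q by simp
      moreover have "?w ! i = \<lceil>\<alpha>\<rceil>"
        using 2 Suc by (simp add: nth_append length_central_word)
      ultimately show ?thesis
        unfolding len e_def using q last by simp
    next
      case 3
      then have "\<not> i < q"
        using Suc by linarith
      then show ?thesis
        unfolding len e_def by simp
    qed
  qed
  have x: "\<bar>1 / \<beta>\<bar> < 1"
    using assms by simp
  have ceil_nz: "\<lceil>\<alpha>\<rceil> \<noteq> 0"
    using assms(1) by (metis less_irrefl zero_less_ceiling)
  have expansion_iff: "has_finite_expansion \<beta> ?w \<longleftrightarrow> (\<forall>i. beta_digit \<beta> i = e i)"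
    unfolding has_finite_expansion_def w using ceil_nz by simp
  let ?r = "digit_tail \<alpha> (1 / \<beta>)"
  have r_period: "?r q = ?r 0"
    by (simp add: digit_tail_def period)
  show ?thesis
  proof
    assume "has_finite_expansion \<beta> ?w"
    then have "beta_digit \<beta> = e"
      using expansion_iff by blast
    then have "1 = (\<Sum>i. of_int (e i) * (1 / \<beta>) ^ Suc i)"
      using beta_digit_sums[OF assms(6)] by (simp add: sums_iff)
    also have "\<dots> = (\<Sum>i<q. of_int (e i) * (1 / \<beta>) ^ Suc i)"
      by (intro suminf_finite) (auto simp: e_def)
    also have "\<dots> = (\<Sum>i<q. of_int (slope_digit \<alpha> i) * (1 / \<beta>) ^ Suc i +
                       (if i = q - 1 then (1 / \<beta>) ^ Suc i else 0))"
      by (intro sum.cong refl) (auto simp: e_def distrib_right simp del: power_Suc)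
    also have "\<dots> = (\<Sum>i<q. of_int (slope_digit \<alpha> i) * (1 / \<beta>) ^ Suc i) + (1 / \<beta>) ^ q"
      using q by (simp add: sum.distrib del: power_Suc)
    finally have sum: "(\<Sum>i<q. of_int (slope_digit \<alpha> i) * (1 / \<beta>) ^ Suc i) = 1 - (1 / \<beta>) ^ q"
      by simp
    \<comment> \<open>What follows one period is a scaled copy of the whole, so \<open>?r 0\<close>
      is a fixed point of an affine map whose only fixed point is 1.\<close>
    have "(\<Sum>i. of_int (slope_digit \<alpha> (i + q)) * (1 / \<beta>) ^ Suc (i + q)) = (1 / \<beta>) ^ q * ?r 0"
      unfolding digit_tail_def
      by (subst suminf_mult[OF summable_slope_digit[OF x], symmetric])
         (simp add: period power_add mult.commute mult.left_commute)
    then have "?r 0 = (1 / \<beta>) ^ q * ?r 0 + (1 - (1 / \<beta>) ^ q)"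
      using suminf_split_initial_segment[OF summable_slope_digit[OF x, of \<alpha> 0], of q] sum
      by (simp add: digit_tail_def)
    then have "(1 - (1 / \<beta>) ^ q) * (?r 0 - 1) = 0"
      by (simp add: algebra_simps)
    moreover have "(1 / \<beta>) ^ q < 1"
      using assms(6) q by (simp add: power_less_one_iff)
    ultimately show "ceil_series \<alpha> (1 / \<beta>) = 0"
      using digit_tail_0_eq_1_iff[OF x] by auto
  next
    assume root: "ceil_series \<alpha> (1 / \<beta>) = 0"
    \<comment> \<open>The periodic remainder returns to 1 at index q; the raised digit at
      \<open>q - 1\<close> absorbs it, so the greedy remainder is 0 from there on.\<close>
    define r where "r i = (if i < q then ?r i else 0)" for i
    have r0: "?r 0 = 1"
      using digit_tail_0_eq_1_iff[OF x] root by blast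
    have r_less: "?r i < 1" if i: "0 < i" "i < q" for i
    proof (rule digit_tail_less_1[OF _ _ root])
      \<comment> \<open>By coprimality the product is an integer only if q divides i, which is
        impossible strictly inside a period.\<close>
      show "\<alpha> * real i \<notin> \<int>"
      proof
        assume "\<alpha> * real i \<in> \<int>"
        then have "\<alpha> * real i - of_int ((\<lceil>\<alpha>\<rceil> - 1) * int i) \<in> \<int>"
          by (intro Ints_diff Ints_of_int)
        then have "real (p * i) / real q \<in> \<int>"
          unfolding shift[of i] by simp
        then obtain k where "real (p * i) / real q = of_int k"
          by (elim Ints_cases)
        then have "real_of_int (int (p * i)) = of_int (k * int q)"
          using q by (simp add: field_simps)
        then have "int (p * i) = k * int q"
          by (simp only: of_int_eq_iff)
        then have "int q dvd int (p * i)"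
          by simp
        then have "q dvd p * i"
          by (simp only: of_nat_dvd_iff)
        then have "q dvd i"
          using assms(4) by (simp add: coprime_commute coprime_dvd_mult_right_iff)
        then show False
          using i by (simp add: nat_dvd_not_less)
      qed
    qed (use assms in auto)
    have "beta_digit \<beta> i = e i" for i
    proof (rule beta_expansion_greedy[of r])
      show "r 0 = 1"
        using q r0 by (simp add: r_def)
      show "\<beta> * r i = of_int (e i) + r (Suc i)" for i
      proof -
        consider "Suc i < q" | "Suc i = q" | "Suc i > q"
          by linarith
        then show ?thesis
        proof cases
          case 2
          then show ?thesis
            using beta_times_digit_tail[OF assms(6), of \<alpha> i] r_period r0 by (auto simp: r_def e_def)
        qed (use beta_times_digit_tail[OF assms(6), of \<alpha> i] in \<open>auto simp: r_def e_def\<close>)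
      qed
      show "0 \<le> r (Suc i)" for i
        using assms by (simp add: r_def digit_tail_nonneg)
      show "r (Suc i) < 1" for i
        using r_less by (simp add: r_def)
    qed
    then show "has_finite_expansion \<beta> ?w"
      using expansion_iff by blast
  qed
qed

text \<open>For rational and irrational \<alpha> alike the defining condition is the root equation
  at \<open>1 / \<beta>\<close>. It has exactly one solution, by continuity and strict monotonicity,
  so the definite descriptions denote it.\<close>

lemma Delta_properties:
  assumes "\<alpha> > 0" "\<alpha> \<notin> \<int>"
  shows "Delta \<alpha> > 1" "ceil_series \<alpha> (1 / Delta \<alpha>) = 0"
proof -
  have "Delta \<alpha> = (THE \<beta>. \<beta> > 1 \<and> ceil_series \<alpha> (1 / \<beta>) = 0)"
  proof (cases "\<alpha> \<in> \<rat>")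
    case True
    define \<gamma> where "\<gamma> = \<alpha> - of_int \<lceil>\<alpha>\<rceil> + 1"
    have "\<gamma> \<in> \<rat>"
      unfolding \<gamma>_def using True by auto
    have "of_int \<lceil>\<alpha>\<rceil> \<noteq> \<alpha>"
      using assms(2) by (metis Ints_of_int)
    then have \<gamma>: "0 < \<gamma>" "\<gamma> < 1"
      unfolding \<gamma>_def by linarith+
    obtain p q :: nat where pq: "q \<noteq> 0" "\<bar>\<gamma>\<bar> = real p / real q" "coprime p q"
      using Rats_abs_nat_div_natE[OF \<open>\<gamma> \<in> \<rat>\<close>] by metis
    have "real p = \<gamma> * real q"
      using pq \<gamma> by (simp add: field_simps)
    then have "0 < real p" "real p < real q"
      using pq \<gamma> by auto
    then have "0 < p" "p < q"
      by simp_all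
    then have ex: "\<exists>p q. 0 < p \<and> p < q \<and> coprime p q \<and> \<alpha> - of_int \<lceil>\<alpha>\<rceil> + 1 = real p / real q"
      using pq \<gamma> unfolding \<gamma>_def by auto
    have "(\<exists>p q. 0 < p \<and> p < q \<and> coprime p q \<and> \<alpha> - of_int \<lceil>\<alpha>\<rceil> + 1 = real p / real q \<and>
        has_finite_expansion \<beta> (\<lceil>\<alpha>\<rceil> # map (recode \<lceil>\<alpha>\<rceil>) (central_word p q) @ [\<lceil>\<alpha>\<rceil>])) \<longleftrightarrow>
        ceil_series \<alpha> (1 / \<beta>) = 0" if "\<beta> > 1" for \<beta>
      using ex has_finite_expansion_iff[OF assms(1) _ _ _ _ that] by blast
    then show ?thesis
      using assms True unfolding Delta_def Let_def by (simp cong: conj_cong)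
  next
    case False
    then show ?thesis
      using assms has_infinite_expansion_iff[OF assms(1) False] unfolding Delta_def Let_def
      by (simp cong: conj_cong)
  qed
  moreover have "\<exists>!\<beta>. \<beta> > 1 \<and> ceil_series \<alpha> (1 / \<beta>) = 0"
  proof -
    obtain x where x: "0 < x" "x < 1" "ceil_series \<alpha> x = 0"
      using ceil_series_root_exists[OF assms(1)] by blast
    have "\<beta> = 1 / x" if "\<beta> > 1" "ceil_series \<alpha> (1 / \<beta>) = 0" for \<beta>
      using ceil_series_strict_mono[OF assms(1), of x "1 / \<beta>"]
        ceil_series_strict_mono[OF assms(1), of "1 / \<beta>" x] x that
      by (cases x "1 / \<beta>" rule: linorder_cases) auto
    then show ?thesis
      using x by (intro ex1I[of _ "1 / x"]) auto
  qed
  ultimately show "Delta \<alpha> > 1" "ceil_series \<alpha> (1 / Delta \<alpha>) = 0"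
    using theI'[of "\<lambda>\<beta>. \<beta> > 1 \<and> ceil_series \<alpha> (1 / \<beta>) = 0"] by auto
qed

section \<open>Perturbation of the slope\<close>

lemma nearest_int_dist_eq: "nearest_int_dist t = \<bar>t - of_int (round t)\<bar>"
  unfolding nearest_int_dist_def
  by (rule cInf_eq_minimum) (auto intro: round_diff_minimal)

lemma nearest_int_dist_le: "nearest_int_dist t \<le> \<bar>t - of_int m\<bar>"
  by (simp add: nearest_int_dist_eq round_diff_minimal)

lemma nearest_int_dist_pos:
  assumes "\<alpha> \<notin> \<rat>" "n > 0"
  shows "nearest_int_dist (real n * \<alpha>) > 0"
  using irrational_mult_nat[OF assms]
  by (auto simp: nearest_int_dist_eq mult.commute) (metis Ints_of_int)

text \<open>The smaller of the two ceilings is an integer lying between the two points.\<close>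

lemma nearest_int_dist_le_if_ceiling_neq:
  assumes "\<lceil>\<alpha> * real n\<rceil> \<noteq> \<lceil>\<alpha>\<^sub>0 * real n\<rceil>"
  shows "nearest_int_dist (real n * \<alpha>\<^sub>0) \<le> real n * \<bar>\<alpha> - \<alpha>\<^sub>0\<bar>"
proof -
  define m where "m = min \<lceil>\<alpha> * real n\<rceil> \<lceil>\<alpha>\<^sub>0 * real n\<rceil>"
  have "\<bar>real n * \<alpha>\<^sub>0 - of_int m\<bar> \<le> \<bar>\<alpha> * real n - \<alpha>\<^sub>0 * real n\<bar>"
  proof (cases "\<lceil>\<alpha> * real n\<rceil> < \<lceil>\<alpha>\<^sub>0 * real n\<rceil>")
    case True
    then have "m = \<lceil>\<alpha> * real n\<rceil>"
      by (simp add: m_def)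
    then show ?thesis
      using True unfolding mult.commute[of "real n"] by linarith
  next
    case False
    then have "m = \<lceil>\<alpha>\<^sub>0 * real n\<rceil>" "\<lceil>\<alpha>\<^sub>0 * real n\<rceil> < \<lceil>\<alpha> * real n\<rceil>"
      using assms by (auto simp: m_def)
    then show ?thesis
      unfolding mult.commute[of "real n"] by linarith
  qed
  also have "\<dots> = real n * \<bar>\<alpha> - \<alpha>\<^sub>0\<bar>"
    by (simp add: abs_mult mult.commute flip: left_diff_distrib)
  finally show ?thesis
    using nearest_int_dist_le[of "real n * \<alpha>\<^sub>0" m] by linarith
qed

text \<open>Uniformity in x is essential, because the bound is applied at the root belonging to
  \<alpha>, which moves with \<alpha>.\<close>

lemma ceil_series_perturbation:
  assumes "c > 0" "l > 1" and c: "\<And>n. n > 0 \<Longrightarrow> c * real n / l ^ n \<le> nearest_int_dist (real n * \<alpha>\<^sub>0)"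
    and "0 \<le> y" "l * y < 1" "e > 0"
  shows "\<forall>\<^sub>F \<alpha> in at \<alpha>\<^sub>0. \<forall>x. 0 \<le> x \<and> x \<le> y \<longrightarrow>
           \<bar>ceil_series \<alpha> x - ceil_series \<alpha>\<^sub>0 x\<bar> \<le> e * \<bar>\<alpha> - \<alpha>\<^sub>0\<bar>"
proof -
  define g where "g n = real (Suc n) * (l * y) ^ n" for n
  have ly: "0 \<le> l * y"
    using assms by simp
  then have g: "summable g"
    using geometric_deriv_sums[of "l * y"] assms(5) unfolding g_def sums_iff by simp
  obtain N where N: "\<bar>\<Sum>i. g (i + N)\<bar> < c * e"
    using suminf_exist_split[OF _ g, of "c * e"] assms by auto
  \<comment> \<open>The bound \<open>c / l ^ N\<close> makes all terms below N vanish; the bound 1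
    keeps the n-th difference of ceilings at most n + 1.\<close>
  define \<delta> where "\<delta> = min 1 (c / l ^ N)"
  show ?thesis
    unfolding eventually_at
  proof (intro exI[of _ \<delta>] conjI ballI impI allI)
    show "\<delta> > 0"
      using assms by (simp add: \<delta>_def)
  next
    fix \<alpha> x
    assume "\<alpha> \<noteq> \<alpha>\<^sub>0 \<and> dist \<alpha> \<alpha>\<^sub>0 < \<delta>" and x: "0 \<le> x \<and> x \<le> y"
    define h where "h = \<bar>\<alpha> - \<alpha>\<^sub>0\<bar>"
    have h: "0 < h" "h \<le> 1" "h < c / l ^ N"
      using \<open>\<alpha> \<noteq> \<alpha>\<^sub>0 \<and> dist \<alpha> \<alpha>\<^sub>0 < \<delta>\<close> by (auto simp: h_def \<delta>_def dist_real_def)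
    have "y \<le> l * y"
      using assms mult_right_mono[of 1 l y] by simp
    then have x1: "\<bar>x\<bar> < 1"
      using x assms by simp
    let ?D = "\<lambda>n. (of_int \<lceil>\<alpha> * real n\<rceil> - of_int \<lceil>\<alpha>\<^sub>0 * real n\<rceil>) * x ^ n"
    have large: "c \<le> h * l ^ n" if "\<lceil>\<alpha> * real n\<rceil> \<noteq> \<lceil>\<alpha>\<^sub>0 * real n\<rceil>" for n
    proof -
      have n: "n > 0"
        using that by (cases n) auto
      have "c * real n / l ^ n \<le> real n * h"
        using nearest_int_dist_le_if_ceiling_neq[OF that] c[OF n] by (simp add: h_def)
      then show ?thesis
        using n assms by (simp add: field_simps)
    qed
    have D0: "?D n = 0" if "n < N" for n
    proof (rule ccontr)
      assume "?D n \<noteq> 0"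
      then have "c \<le> h * l ^ n"
        using large by auto
      also have "\<dots> \<le> h * l ^ N"
        using h assms that by (intro mult_left_mono power_increasing) auto
      also have "\<dots> < c"
        using h assms by (simp add: field_simps)
      finally show False
        by simp
    qed
    have D_le: "\<bar>?D n\<bar> \<le> h / c * g n" for n
    proof (cases "\<lceil>\<alpha> * real n\<rceil> = \<lceil>\<alpha>\<^sub>0 * real n\<rceil>")
      case True
      then show ?thesis
        using h assms ly by (simp add: g_def)
    next
      case False
      have "\<bar>\<alpha> * real n - \<alpha>\<^sub>0 * real n\<bar> = h * real n"
        by (simp add: h_def abs_mult flip: left_diff_distrib)
      also have "\<dots> \<le> real n"
        using h mult_right_mono[of h 1 "real n"] by simp
      finally have "\<bar>of_int \<lceil>\<alpha> * real n\<rceil> - of_int \<lceil>\<alpha>\<^sub>0 * real n\<rceil>\<bar> \<le> real (Suc n)"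
        by (simp add: abs_le_iff) linarith
      moreover have "x ^ n \<le> y ^ n"
        using x by (simp add: power_mono)
      ultimately have "\<bar>?D n\<bar> \<le> real (Suc n) * y ^ n"
        unfolding abs_mult using x by (intro mult_mono) auto
      \<comment> \<open>The inserted factor is at least 1 wherever the ceilings differ; it trades
        the ratio y for \<open>l * y\<close> and gains the factor h.\<close>
      also have "\<dots> \<le> (h * l ^ n / c) * (real (Suc n) * y ^ n)"
        using large[OF False] assms mult_right_mono[of 1 "h * l ^ n / c" "real (Suc n) * y ^ n"]
        by simp
      also have "\<dots> = h / c * g n"
        by (simp add: g_def power_mult_distrib)
      finally show ?thesis .
    qed
    have sD: "summable (\<lambda>n. \<bar>?D n\<bar>)"
      by (rule summable_comparison_test'[OF summable_mult[OF g, of "h / c"], of 0])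
         (simp only: abs_abs real_norm_def D_le)
    have gN: "summable (\<lambda>n. g (n + N))"
      using g summable_iff_shift by blast
    have sDN: "summable (\<lambda>n. \<bar>?D (n + N)\<bar>)"
      by (subst summable_iff_shift[of "\<lambda>n. \<bar>?D n\<bar>"]) (rule sD)
    have "\<bar>ceil_series \<alpha> x - ceil_series \<alpha>\<^sub>0 x\<bar> = \<bar>suminf ?D\<bar>"
      unfolding ceil_series_def
      by (subst suminf_diff[OF summable_ceil_series[OF x1] summable_ceil_series[OF x1]])
         (simp add: algebra_simps)
    also have "suminf ?D = (\<Sum>n. ?D (n + N))"
      using suminf_split_initial_segment[OF summable_rabs_cancel[OF sD], of N] D0 by simp
    also have "\<bar>\<Sum>n. ?D (n + N)\<bar> \<le> (\<Sum>n. \<bar>?D (n + N)\<bar>)"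
      by (rule summable_rabs[OF sDN])
    also have "\<dots> \<le> (\<Sum>n. h / c * g (n + N))"
      by (intro suminf_le sDN summable_mult gN D_le)
    also have "\<dots> = h / c * (\<Sum>n. g (n + N))"
      by (rule suminf_mult[OF gN])
    also have "\<dots> \<le> h / c * (c * e)"
      using N h assms by (intro mult_left_mono) auto
    also have "\<dots> = e * \<bar>\<alpha> - \<alpha>\<^sub>0\<bar>"
      using assms by (simp add: h_def)
    finally show "\<bar>ceil_series \<alpha> x - ceil_series \<alpha>\<^sub>0 x\<bar> \<le> e * \<bar>\<alpha> - \<alpha>\<^sub>0\<bar>" .
  qed
qed

text \<open>Every ceiling is monotone in the slope, so all terms of the difference are nonnegative
  and the one at q survives as a lower bound.\<close>

lemma ceil_series_jump:
  assumes "\<alpha> \<le> \<alpha>'" "\<lceil>\<alpha> * real q\<rceil> < \<lceil>\<alpha>' * real q\<rceil>" "0 \<le> x" "x < 1"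
  shows "x ^ q \<le> ceil_series \<alpha>' x - ceil_series \<alpha> x"
proof -
  have x: "\<bar>x\<bar> < 1"
    using assms by simp
  let ?D = "\<lambda>n. (of_int \<lceil>\<alpha>' * real n\<rceil> - of_int \<lceil>\<alpha> * real n\<rceil>) * x ^ n"
  have sD: "summable ?D"
    using summable_diff[OF summable_ceil_series[OF x] summable_ceil_series[OF x], of \<alpha>' \<alpha>]
    by (simp add: algebra_simps)
  have "1 \<le> real_of_int \<lceil>\<alpha>' * real q\<rceil> - of_int \<lceil>\<alpha> * real q\<rceil>"
    using assms(2) by linarith
  then have "x ^ q \<le> sum ?D {q}"
    using assms mult_right_mono[of 1 "of_int \<lceil>\<alpha>' * real q\<rceil> - of_int \<lceil>\<alpha> * real q\<rceil>" "x ^ q"]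
    by simp
  also have "\<dots> \<le> suminf ?D"
  proof (rule sum_le_suminf[OF sD])
    show "0 \<le> ?D n" for n
      using assms by (intro mult_nonneg_nonneg) (auto intro!: ceiling_mono mult_right_mono)
  qed auto
  also have "\<dots> = ceil_series \<alpha>' x - ceil_series \<alpha> x"
    unfolding ceil_series_def
    by (subst suminf_diff[OF summable_ceil_series[OF x] summable_ceil_series[OF x]])
       (simp add: algebra_simps)
  finally show ?thesis .
qed

text \<open>Nearby slopes stay strictly between the same two consecutive integers, so
  \<open>Delta_properties\<close> applies to them.\<close>

lemma eventually_pos_nonint:
  fixes \<alpha>\<^sub>0 :: real
  assumes "\<alpha>\<^sub>0 > 0" "\<alpha>\<^sub>0 \<notin> \<int>"
  shows "\<forall>\<^sub>F \<alpha> in at \<alpha>\<^sub>0. \<alpha> > 0 \<and> \<alpha> \<notin> \<int>"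
proof -
  have "of_int \<lfloor>\<alpha>\<^sub>0\<rfloor> \<noteq> \<alpha>\<^sub>0"
    using assms(2) by (metis Ints_of_int)
  then have "\<alpha>\<^sub>0 \<in> {of_int \<lfloor>\<alpha>\<^sub>0\<rfloor><..<of_int \<lfloor>\<alpha>\<^sub>0\<rfloor> + 1}"
    unfolding greaterThanLessThan_iff by linarith
  then have "\<forall>\<^sub>F \<alpha> in at \<alpha>\<^sub>0. \<alpha> \<in> {of_int \<lfloor>\<alpha>\<^sub>0\<rfloor><..<of_int \<lfloor>\<alpha>\<^sub>0\<rfloor> + 1}"
    by (intro eventually_at_in_open') auto
  then show ?thesis
  proof eventually_elim
    case (elim \<alpha>)
    moreover have "\<lfloor>\<alpha>\<^sub>0\<rfloor> \<ge> 0"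
      using assms by simp
    ultimately have "\<alpha> > 0"
      by (smt (verit) greaterThanLessThan_iff of_int_0_le_iff)
    moreover have "\<alpha> \<notin> \<int>"
    proof
      assume "\<alpha> \<in> \<int>"
      then obtain k where k: "\<alpha> = of_int k"
        by (elim Ints_cases)
      then have "\<lfloor>\<alpha>\<^sub>0\<rfloor> < k" "k < \<lfloor>\<alpha>\<^sub>0\<rfloor> + 1"
        using elim by (simp_all flip: of_int_less_iff)
      then show False
        by simp
    qed
    ultimately show ?case
      by simp
  qed
qed

section \<open>Differentiability at irrational slopes\<close>

text \<open>Each series vanishes at its own root, so \<open>ceil_series_expanding\<close> at
  \<open>X \<alpha>\<^sub>0\<close> turns the perturbation bound at the moving root
  \<open>X \<alpha>\<close> into one for \<open>X \<alpha> - X \<alpha>\<^sub>0\<close>. Inverting X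
  gives \<open>Delta\<close>.\<close>

lemma Delta_has_derivative_0:
  assumes "\<alpha>\<^sub>0 > 0" "\<alpha>\<^sub>0 \<notin> \<int>" "c > 0" "l > 1" "l < Delta \<alpha>\<^sub>0"
    and c: "\<And>n. n > 0 \<Longrightarrow> c * real n / l ^ n \<le> nearest_int_dist (real n * \<alpha>\<^sub>0)"
  shows "(Delta has_real_derivative 0) (at \<alpha>\<^sub>0)"
proof -
  define X where "X \<alpha> = inverse (Delta \<alpha>)" for \<alpha>
  have X: "0 < X \<alpha>" "X \<alpha> < 1" "ceil_series \<alpha> (X \<alpha>) = 0" if "\<alpha> > 0 \<and> \<alpha> \<notin> \<int>" for \<alpha>
    using Delta_properties[of \<alpha>] that by (auto simp: X_def inverse_eq_divide)
  note X0 = X[of \<alpha>\<^sub>0]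
  obtain k where k: "k > 0" "\<lceil>\<alpha>\<^sub>0 * real k\<rceil> \<ge> 2"
    using ex_ceiling_ge[OF assms(1), of 2] by auto
  have "X \<alpha>\<^sub>0 < 1 / l"
    using assms(4,5) by (simp add: X_def inverse_eq_divide frac_less2)
  \<comment> \<open>Above the root, so that nearby roots stay below y, and below
    \<open>1 / l\<close>, as the perturbation bound requires.\<close>
  then obtain y where y: "X \<alpha>\<^sub>0 < y" "y < 1 / l"
    using dense by blast
  have ly: "l * y < 1"
    using y assms by (simp add: field_simps)
  have y0: "0 \<le> y"
    using y X0 assms by simp
  have "1 / l < 1"
    using assms(4) by simp
  then have y1: "y < 1"
    using y by linarith
  have perturb: "\<forall>\<^sub>F \<alpha> in at \<alpha>\<^sub>0. \<forall>x. 0 \<le> x \<and> x \<le> y \<longrightarrow>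
      \<bar>ceil_series \<alpha> x - ceil_series \<alpha>\<^sub>0 x\<bar> \<le> e * \<bar>\<alpha> - \<alpha>\<^sub>0\<bar>" if "e > 0" for e
    by (rule ceil_series_perturbation[OF assms(3,4) _ y0 ly that]) (rule c)
  \<comment> \<open>A perturbation smaller than \<eta> keeps the series positive at y, which forces
    its root below y. Continuity of X is not presupposed.\<close>
  define \<eta> where "\<eta> = ceil_series \<alpha>\<^sub>0 y"
  have \<eta>: "\<eta> > 0"
    unfolding \<eta>_def using ceil_series_strict_mono[OF assms(1), of "X \<alpha>\<^sub>0" y] X0 y y1 assms by simp
  have "\<forall>\<^sub>F \<alpha> in at \<alpha>\<^sub>0. dist \<alpha> \<alpha>\<^sub>0 < \<eta>"
    using \<eta> by (auto simp: eventually_at)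
  moreover note eventually_pos_nonint[OF assms(1,2)]
  moreover note perturb[OF zero_less_one]
  ultimately have X_less: "\<forall>\<^sub>F \<alpha> in at \<alpha>\<^sub>0. X \<alpha> < y"
  proof eventually_elim
    case (elim \<alpha>)
    then have "\<bar>ceil_series \<alpha> y - \<eta>\<bar> \<le> 1 * \<bar>\<alpha> - \<alpha>\<^sub>0\<bar>"
      using y0 unfolding \<eta>_def by blast
    then have "ceil_series \<alpha> y > 0"
      using elim(1) by (simp add: dist_real_def)
    then show ?case
      using ceil_series_strict_mono[of \<alpha> y "X \<alpha>"] X[of \<alpha>] elim y0
      by (cases "X \<alpha>" y rule: linorder_cases) auto
  qed
  have "((\<lambda>\<alpha>. (X \<alpha> - X \<alpha>\<^sub>0) / (\<alpha> - \<alpha>\<^sub>0)) \<longlongrightarrow> 0) (at \<alpha>\<^sub>0)"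
  proof (rule tendstoI)
    fix \<epsilon> :: real
    assume "\<epsilon> > 0"
    define w where "w = X \<alpha>\<^sub>0 ^ (k - 1)"
    have w: "w > 0"
      using X0 assms by (simp add: w_def)
    \<comment> \<open>Cancelling the expansion constant w leaves half of \<epsilon>; halving makes
      the final inequality strict.\<close>
    define e where "e = w * (\<epsilon> / 2)"
    have "e > 0"
      using w \<open>\<epsilon> > 0\<close> by (simp add: e_def)
    note perturb[OF this]
    moreover note X_less eventually_pos_nonint[OF assms(1,2)] eventually_neq_at_within[of \<alpha>\<^sub>0]
    ultimately show "\<forall>\<^sub>F \<alpha> in at \<alpha>\<^sub>0. dist ((X \<alpha> - X \<alpha>\<^sub>0) / (\<alpha> - \<alpha>\<^sub>0)) 0 < \<epsilon>"
    proof eventually_elim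
      case (elim \<alpha>)
      note X\<alpha> = X[OF elim(3)]
      have "w * \<bar>X \<alpha> - X \<alpha>\<^sub>0\<bar> \<le> \<bar>ceil_series \<alpha>\<^sub>0 (X \<alpha>) - ceil_series \<alpha>\<^sub>0 (X \<alpha>\<^sub>0)\<bar>"
        unfolding w_def using ceil_series_expanding[OF assms(1) k, of "X \<alpha>\<^sub>0" "X \<alpha>"] X\<alpha> X0 assms
        by simp
      also have "\<dots> = \<bar>ceil_series \<alpha> (X \<alpha>) - ceil_series \<alpha>\<^sub>0 (X \<alpha>)\<bar>"
        using X\<alpha> X0 assms by simp
      also have "\<dots> \<le> e * \<bar>\<alpha> - \<alpha>\<^sub>0\<bar>"
        using elim(1)[rule_format, of "X \<alpha>"] elim(2) X\<alpha>(1) by linarith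
      finally have "\<bar>X \<alpha> - X \<alpha>\<^sub>0\<bar> \<le> \<epsilon> / 2 * \<bar>\<alpha> - \<alpha>\<^sub>0\<bar>"
        using w by (simp add: e_def)
      also have "\<dots> < \<epsilon> * \<bar>\<alpha> - \<alpha>\<^sub>0\<bar>"
        using \<open>\<epsilon> > 0\<close> elim by simp
      finally show ?case
        using elim by (simp add: divide_less_eq)
    qed
  qed
  then have "(X has_real_derivative 0) (at \<alpha>\<^sub>0)"
    by (simp add: has_field_derivative_iff)
  from DERIV_inverse'[OF this] X0 assms show ?thesis
    by (simp add: X_def)
qed

text \<open>The jump of the series at a rational \<open>p / q\<close> separates \<open>\<alpha>\<^sub>0\<close> from \<open>p / q\<close> itself when
  \<open>p / q < \<alpha>\<^sub>0\<close>, and from the mirror image of \<open>\<alpha>\<^sub>0\<close> in \<open>p / q\<close> otherwise.\<close>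

lemma ceil_series_jump_near:
  assumes "\<alpha>\<^sub>0 \<notin> \<rat>" "q > 0"
  obtains \<alpha> where "\<alpha> \<noteq> \<alpha>\<^sub>0" "\<bar>\<alpha> - \<alpha>\<^sub>0\<bar> \<le> 2 * nearest_int_dist (real q * \<alpha>\<^sub>0) / real q"
    and "\<And>x. 0 \<le> x \<Longrightarrow> x < 1 \<Longrightarrow> x ^ q \<le> \<bar>ceil_series \<alpha> x - ceil_series \<alpha>\<^sub>0 x\<bar>"
proof -
  define p where "p = round (real q * \<alpha>\<^sub>0)"
  define s where "s = of_int p / real q"
  have q: "real q > 0"
    using assms by simp
  have sq: "s * real q = of_int p"
    using q by (simp add: s_def)
  have "s \<in> \<rat>"
    by (simp add: s_def)
  then have ne: "s \<noteq> \<alpha>\<^sub>0"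
    using assms by blast
  have "nearest_int_dist (real q * \<alpha>\<^sub>0) = \<bar>\<alpha>\<^sub>0 - s\<bar> * real q"
    unfolding nearest_int_dist_eq p_def[symmetric] sq[symmetric]
    by (simp add: abs_mult mult.commute flip: left_diff_distrib)
  then have dist: "2 * nearest_int_dist (real q * \<alpha>\<^sub>0) / real q = 2 * \<bar>\<alpha>\<^sub>0 - s\<bar>"
    using q by simp
  show ?thesis
  proof (cases "s < \<alpha>\<^sub>0")
    case True
    then have "of_int p < \<alpha>\<^sub>0 * real q"
      using q by (simp add: sq[symmetric])
    then have "\<lceil>s * real q\<rceil> < \<lceil>\<alpha>\<^sub>0 * real q\<rceil>"
      by (simp add: sq less_ceiling_iff)
    then have "x ^ q \<le> \<bar>ceil_series s x - ceil_series \<alpha>\<^sub>0 x\<bar>" if "0 \<le> x" "x < 1" for x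
      using ceil_series_jump[of s \<alpha>\<^sub>0 q x] True that by linarith
    moreover have "\<bar>s - \<alpha>\<^sub>0\<bar> \<le> 2 * nearest_int_dist (real q * \<alpha>\<^sub>0) / real q"
      unfolding dist abs_minus_commute[of s] by (simp add: mult_le_cancel_right1)
    ultimately show ?thesis
      using ne by (intro that[of s]) auto
  next
    case False
    then have gt: "\<alpha>\<^sub>0 < s"
      using ne by simp
    \<comment> \<open>The ceiling jumps only strictly beyond s, so s itself would not do when
      approached from below.\<close>
    define \<alpha> where "\<alpha> = 2 * s - \<alpha>\<^sub>0"
    have "\<alpha>\<^sub>0 * real q < s * real q" "s * real q < \<alpha> * real q"
      using gt q by (auto simp: \<alpha>_def)
    then have "\<lceil>\<alpha>\<^sub>0 * real q\<rceil> \<le> p" "p < \<lceil>\<alpha> * real q\<rceil>"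
      unfolding sq by (simp_all add: ceiling_le_iff less_ceiling_iff)
    then have "x ^ q \<le> \<bar>ceil_series \<alpha> x - ceil_series \<alpha>\<^sub>0 x\<bar>" if "0 \<le> x" "x < 1" for x
      using ceil_series_jump[of \<alpha>\<^sub>0 \<alpha> q x] gt that by (simp add: \<alpha>_def)
    then show ?thesis
      by (intro that[of \<alpha>]) (use gt dist in \<open>auto simp: \<alpha>_def\<close>)
  qed
qed

lemma eventually_deriv_bound:
  assumes "(f has_real_derivative E) (at a)"
  shows "\<forall>\<^sub>F y in at a. \<bar>f y - f a\<bar> \<le> (\<bar>E\<bar> + 1) * \<bar>y - a\<bar>"
proof -
  have "((\<lambda>y. \<bar>(f y - f a) / (y - a)\<bar>) \<longlongrightarrow> \<bar>E\<bar>) (at a)"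
    using assms by (intro tendsto_rabs) (simp add: has_field_derivative_iff)
  then have "\<forall>\<^sub>F y in at a. \<bar>(f y - f a) / (y - a)\<bar> < \<bar>E\<bar> + 1"
    by (rule order_tendstoD) simp
  moreover note eventually_neq_at_within[of a]
  ultimately show ?thesis
    by eventually_elim (simp add: divide_less_eq)
qed

text \<open>Differentiability would pass to the reciprocal X, and
  \<open>ceil_series \<alpha>\<^sub>0 (X \<alpha>)\<close>, which vanishes at
  \<open>\<alpha>\<^sub>0\<close>, would be bounded by a multiple of the increment. At the slope
  from \<open>ceil_series_jump_near\<close> it is at least \<open>(1 / l) ^ q\<close>, which is too
  large.\<close>

lemma Delta_not_differentiable:
  assumes "\<alpha>\<^sub>0 > 0" "\<alpha>\<^sub>0 \<notin> \<rat>" "l > Delta \<alpha>\<^sub>0"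
    and freq: "\<And>e. e > 0 \<Longrightarrow> \<exists>q>0. l ^ q / real q * nearest_int_dist (real q * \<alpha>\<^sub>0) < e"
  shows "\<not> Delta differentiable (at \<alpha>\<^sub>0)"
proof
  assume "Delta differentiable (at \<alpha>\<^sub>0)"
  then obtain D where D: "(Delta has_real_derivative D) (at \<alpha>\<^sub>0)"
    by (auto simp: real_differentiable_def)
  have nonint: "\<alpha>\<^sub>0 \<notin> \<int>"
    using assms(2) Ints_subset_Rats by blast
  define X where "X \<alpha> = inverse (Delta \<alpha>)" for \<alpha>
  have X: "0 < X \<alpha>" "X \<alpha> < 1" "ceil_series \<alpha> (X \<alpha>) = 0" if "\<alpha> > 0 \<and> \<alpha> \<notin> \<int>" for \<alpha>
    using Delta_properties[of \<alpha>] that by (auto simp: X_def inverse_eq_divide)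
  have X0: "0 < X \<alpha>\<^sub>0" "X \<alpha>\<^sub>0 < 1" "ceil_series \<alpha>\<^sub>0 (X \<alpha>\<^sub>0) = 0"
    using X[of \<alpha>\<^sub>0] assms nonint by auto
  have Delta0: "Delta \<alpha>\<^sub>0 > 1"
    using Delta_properties assms(1) nonint by blast
  have l: "l > 1"
    using Delta0 assms(3) by simp
  obtain DX where DX: "(X has_real_derivative DX) (at \<alpha>\<^sub>0)"
    using DERIV_inverse'[OF D] Delta0 unfolding X_def[abs_def] by auto
  obtain DK where DK: "(ceil_series \<alpha>\<^sub>0 has_real_derivative DK) (at (X \<alpha>\<^sub>0))"
    using ceil_series_differentiable[of "X \<alpha>\<^sub>0" \<alpha>\<^sub>0] X0 by auto
  define M where "M = \<bar>DK * DX\<bar> + 1"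
  have M: "M > 0"
    by (simp add: M_def)
  have "\<forall>\<^sub>F \<alpha> in at \<alpha>\<^sub>0. \<bar>ceil_series \<alpha>\<^sub>0 (X \<alpha>)\<bar> \<le> M * \<bar>\<alpha> - \<alpha>\<^sub>0\<bar>"
    using eventually_deriv_bound[OF DERIV_chain2[OF DK DX]] X0 by (simp add: M_def)
  moreover have "1 / l < X \<alpha>\<^sub>0"
    using Delta0 assms(3) by (simp add: X_def inverse_eq_divide frac_less2)
  then have "\<forall>\<^sub>F \<alpha> in at \<alpha>\<^sub>0. 1 / l < X \<alpha>"
    using DERIV_isCont[OF DX] by (intro order_tendstoD(1)) (auto simp: isCont_def)
  moreover note eventually_pos_nonint[OF assms(1) nonint]
  ultimately have "\<forall>\<^sub>F \<alpha> in at \<alpha>\<^sub>0. \<bar>ceil_series \<alpha>\<^sub>0 (X \<alpha>)\<bar> \<le> M * \<bar>\<alpha> - \<alpha>\<^sub>0\<bar> \<and>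
      1 / l < X \<alpha> \<and> \<alpha> > 0 \<and> \<alpha> \<notin> \<int>"
    by eventually_elim blast
  then obtain \<delta> where \<delta>: "\<delta> > 0" and near: "\<And>\<alpha>. \<alpha> \<noteq> \<alpha>\<^sub>0 \<Longrightarrow> \<bar>\<alpha> - \<alpha>\<^sub>0\<bar> < \<delta> \<Longrightarrow>
      \<bar>ceil_series \<alpha>\<^sub>0 (X \<alpha>)\<bar> \<le> M * \<bar>\<alpha> - \<alpha>\<^sub>0\<bar> \<and> 1 / l < X \<alpha> \<and> \<alpha> > 0 \<and> \<alpha> \<notin> \<int>"
    unfolding eventually_at dist_real_def by auto
  \<comment> \<open>The first bound places the chosen slope within \<delta>, since
    \<open>l ^ q \<ge> 1\<close>; the second makes the final chain end in 1 < 1.\<close>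
  define e where "e = min (\<delta> / 2) (1 / (2 * M))"
  have e: "e > 0" "2 * e \<le> \<delta>" "M * (2 * e) \<le> 1"
    using \<delta> M by (auto simp: e_def min_def field_simps)
  obtain q where q: "q > 0" "l ^ q / real q * nearest_int_dist (real q * \<alpha>\<^sub>0) < e"
    using freq[OF e(1)] by blast
  obtain \<alpha> where \<alpha>: "\<alpha> \<noteq> \<alpha>\<^sub>0" "\<bar>\<alpha> - \<alpha>\<^sub>0\<bar> \<le> 2 * nearest_int_dist (real q * \<alpha>\<^sub>0) / real q"
    and jump: "\<And>x. 0 \<le> x \<Longrightarrow> x < 1 \<Longrightarrow> x ^ q \<le> \<bar>ceil_series \<alpha> x - ceil_series \<alpha>\<^sub>0 x\<bar>"
    using ceil_series_jump_near[OF assms(2) q(1)] by blast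
  have lq: "l ^ q \<ge> 1"
    using l by simp
  have "l ^ q * \<bar>\<alpha> - \<alpha>\<^sub>0\<bar> \<le> l ^ q * (2 * nearest_int_dist (real q * \<alpha>\<^sub>0) / real q)"
    using \<alpha> lq by (intro mult_left_mono) auto
  also have "\<dots> = 2 * (l ^ q / real q * nearest_int_dist (real q * \<alpha>\<^sub>0))"
    by simp
  also have "\<dots> < 2 * e"
    using q(2) by linarith
  finally have small: "l ^ q * \<bar>\<alpha> - \<alpha>\<^sub>0\<bar> < 2 * e" .
  have "\<bar>\<alpha> - \<alpha>\<^sub>0\<bar> \<le> l ^ q * \<bar>\<alpha> - \<alpha>\<^sub>0\<bar>"
    using mult_right_mono[OF lq, of "\<bar>\<alpha> - \<alpha>\<^sub>0\<bar>"] by simp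
  then have "\<bar>\<alpha> - \<alpha>\<^sub>0\<bar> < \<delta>"
    using small e by linarith
  note N = near[OF \<alpha>(1) this]
  note X\<alpha> = X[of \<alpha>]
  have "1 = l ^ q * (1 / l) ^ q"
    using l by (simp add: power_divide)
  also have "\<dots> \<le> l ^ q * X \<alpha> ^ q"
    using N l by (intro mult_left_mono power_mono) auto
  also have "\<dots> \<le> l ^ q * (M * \<bar>\<alpha> - \<alpha>\<^sub>0\<bar>)"
    using jump[of "X \<alpha>"] X\<alpha> N lq by (intro mult_left_mono) auto
  also have "\<dots> < M * (2 * e)"
    using small M mult_strict_left_mono[OF small M] by (simp add: mult.left_commute)
  finally show False
    using e by simp
qed

section \<open>Diophantine inequalities from the irrationality base\<close>

text \<open>As l exceeds the supremum, its liminf is nonzero, hence positive, which gives a constant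
  for large n. The finitely many other values are positive by irrationality, so a minimum covers all
  n > 0.\<close>

lemma irrationality_base_less_imp_bound:
  assumes "\<alpha> \<notin> \<rat>" "irrationality_base \<alpha> < ereal l" "l > 1"
  obtains c where "c > 0" "\<And>n. n > 0 \<Longrightarrow> c * real n / l ^ n \<le> nearest_int_dist (real n * \<alpha>)"
proof -
  define f where "f n = l ^ n / real n * nearest_int_dist (real n * \<alpha>)" for n
  have f_pos: "f n > 0" if "n > 0" for n
    using that assms(3) nearest_int_dist_pos[OF assms(1) that] by (simp add: f_def)
  \<comment> \<open>Division by zero makes \<open>f 0 = 0\<close>; this does not affect the liminf,
    and the minimum d below starts at index 1.\<close>
  have "f n \<ge> 0" for n
    using f_pos[of n] by (cases "n = 0") (auto simp: f_def)
  then have "liminf (\<lambda>n. ereal (f n)) \<ge> 0"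
    by (intro Liminf_bounded) auto
  moreover have "liminf (\<lambda>n. ereal (f n)) \<noteq> 0"
  proof
    assume "liminf (\<lambda>n. ereal (f n)) = 0"
    then have "ereal l \<le> irrationality_base \<alpha>"
      unfolding irrationality_base_def f_def by (intro Sup_upper) blast
    then show False
      using assms(2) by simp
  qed
  ultimately have "0 < liminf (\<lambda>n. ereal (f n))"
    by simp
  then obtain c where c: "0 < ereal c" "ereal c < liminf (\<lambda>n. ereal (f n))"
    using ereal_dense2 by blast
  then obtain N where N: "\<And>n. n \<ge> N \<Longrightarrow> c < f n"
    using less_LiminfD[OF c(2)] by (auto simp: eventually_sequentially)
  define d where "d = Min (insert c (f ` {1..N}))"
  have "d > 0"
    unfolding d_def using c f_pos by (subst Min_gr_iff) auto
  moreover have "d * real n / l ^ n \<le> nearest_int_dist (real n * \<alpha>)" if "n > 0" for n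
  proof -
    have "d \<le> f n"
    proof (cases "n \<le> N")
      case True
      then show ?thesis
        unfolding d_def using that by (intro Min_le) auto
    next
      case False
      then have "c < f n"
        by (intro N) simp
      moreover have "d \<le> c"
        unfolding d_def by (intro Min_le) auto
      ultimately show ?thesis
        by simp
    qed
    then show ?thesis
      using that assms(3) by (simp add: f_def field_simps)
  qed
  ultimately show ?thesis
    by (rule that)
qed

text \<open>Some l > b lies in the set defining the supremum, and a liminf of 0 excludes a positive
  lower bound over all q > 0.\<close>

lemma less_irrationality_base_imp_freq:
  assumes "ereal b < irrationality_base \<alpha>"
  obtains l where "l > b"
    "\<And>e. e > 0 \<Longrightarrow> \<exists>q>0. l ^ q / real q * nearest_int_dist (real q * \<alpha>) < e"
proof -
  obtain l where l: "b < l"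
      and lim: "liminf (\<lambda>q. ereal (l ^ q / real q * nearest_int_dist (real q * \<alpha>))) = 0"
    using assms unfolding irrationality_base_def less_Sup_iff by auto
  have "\<exists>q>0. l ^ q / real q * nearest_int_dist (real q * \<alpha>) < e" if "e > 0" for e
  proof (rule ccontr)
    assume "\<not> ?thesis"
    then have "e \<le> l ^ q / real q * nearest_int_dist (real q * \<alpha>)" if "q > 0" for q
      using that not_less by blast
    then have "\<forall>\<^sub>F q in sequentially.
        ereal e \<le> ereal (l ^ q / real q * nearest_int_dist (real q * \<alpha>))"
      by (intro eventually_mono[OF eventually_gt_at_top[of 0]]) (simp only: ereal_less_eq)
    from Liminf_bounded[OF this] show False
      using lim that by simp
  qed
  with l show ?thesis
    by (rule that)
qed

theorem theorem4p13:
  fixes \<alpha>\<^sub>0 :: real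
  assumes "\<alpha>\<^sub>0 > 0" and "\<alpha>\<^sub>0 \<notin> \<rat>"
  shows "(irrationality_base \<alpha>\<^sub>0 < ereal (Delta \<alpha>\<^sub>0) \<longrightarrow>
            (Delta has_real_derivative 0) (at \<alpha>\<^sub>0)) \<and>
         (irrationality_base \<alpha>\<^sub>0 > ereal (Delta \<alpha>\<^sub>0) \<longrightarrow>
            \<not> Delta differentiable (at \<alpha>\<^sub>0))"
proof (intro conjI impI)
  have nonint: "\<alpha>\<^sub>0 \<notin> \<int>"
    using assms(2) Ints_subset_Rats by blast
  assume "irrationality_base \<alpha>\<^sub>0 < ereal (Delta \<alpha>\<^sub>0)"
  \<comment> \<open>The maximum with 1 yields an l that also exceeds 1, as both lemmas applied to it
    require.\<close>
  then have "max (irrationality_base \<alpha>\<^sub>0) (ereal 1) < ereal (Delta \<alpha>\<^sub>0)"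
    using Delta_properties(1)[OF assms(1) nonint] by simp
  then obtain l where "max (irrationality_base \<alpha>\<^sub>0) (ereal 1) < ereal l" and l: "l < Delta \<alpha>\<^sub>0"
    using ereal_dense2 by (metis ereal_less_eq(3) not_le)
  then have "irrationality_base \<alpha>\<^sub>0 < ereal l" "l > 1"
    by simp_all
  with irrationality_base_less_imp_bound[OF assms(2)] obtain c
    where "c > 0" "\<And>n. n > 0 \<Longrightarrow> c * real n / l ^ n \<le> nearest_int_dist (real n * \<alpha>\<^sub>0)"
    by blast
  then show "(Delta has_real_derivative 0) (at \<alpha>\<^sub>0)"
    using Delta_has_derivative_0[OF assms(1) nonint _ \<open>l > 1\<close> l] by blast
next
  assume "irrationality_base \<alpha>\<^sub>0 > ereal (Delta \<alpha>\<^sub>0)"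
  then show "\<not> Delta differentiable (at \<alpha>\<^sub>0)"
    using less_irrationality_base_imp_freq Delta_not_differentiable[OF assms] by metis
qed

end
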